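(* Let $G=(V,E)$ be a graph, and let $\Gamma$ be either $\mathbb{R}$ or $\mathbb{R}/2\pi\mathbb{Z}$. For each edge $e\in E$ let $f_e:\Gamma\to\mathbb{R}$ be an odd function such that $|f_e^{-1}(y)|\le d<\infty$ for every $y\in\mathbb{R}$, where $d$ is an absolute constant (independent of $e$ and $y$). Fix $\omega\in\mathbb{R}^V$ and let $X=\{x\in\Gamma^V:\dot x=0\}$ be the set of equilibria of the vector field $$\dot x_v=\omega_v+\sum_{w\in N(v)}f_{\{w,v\}}(x_w-x_v),\qquad v\in V.$$ Let $c_1,\dots,c_m$ be oriented cycles in $G$ with no repeated edges. Suppose that any two of these cycles have at most one common edge. Let $F$ be the graph with vertices $c_1,\dots,c_m$ and edges the pairs $\{c_i,c_j\}$, $i\ne j$, such that $c_i$ and $c_j$ have common edges. Suppose moreover that $F$ is a forest with no isolated vertices. Let $L\subseteq F$ be obtained by choosing from each connected component of $F$ all leaves except one. Then $$\dim_{\mathrm{an}}(X)\le \dim_{\mathbb{R}}\mathrm{H}_0(G)+\dim_{\mathbb{R}}\mathrm{H}_1(G)-|F|+|L|.$$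
   Context: A graph $G=(V,E)$ is a pair of finite sets with $V\neq\emptyset$ and $E$ a set of $2$-element subsets of $V$; $N(v)$ is the set of neighbors of $v$; $|F|=m$ is the number of vertices of $F$. A leaf is a vertex of degree $1$. Fix an arbitrary orientation of the edges, and let $B\in\{+1,-1,0\}^{V\times E}$ be the incidence matrix: for an edge oriented as $(w,u)$, $B_{v,(w,u)}=1$ if $v=u$, $-1$ if $v=w$, and $0$ otherwise. The zeroth homology group $\mathrm{H}_0(G)=\ker B^t\subseteq\Gamma^V$ consists of the vectors constant on each connected component and has dimension $\dim_{\mathbb{R}}\mathrm{H}_0(G)=c(G)$, the number of connected components of $G$. The first homology group is $\mathrm{H}_1(G)=\ker B\subseteq\mathbb{R}^E$, of dimension $\dim_{\mathbb{R}}\mathrm{H}_1(G)=|E|-|V|+c(G)$. The analytic dimension $\dim_{\mathrm{an}}(X)$ of $X$ is the maximum dimension of a (smooth) manifold contained in $X$. *)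

theory Defs
  imports "HOL-Analysis.Analysis"
begin

section \<open>The phase space\<close>

text \<open>
  The class axioms say that \<open>proj\<close> is an epimorphism from the additive group of the reals with
  kernel \<open>0\<close> or \<open>2\<pi>\<int>\<close>, so the instances are exactly the copies of \<open>\<real>\<close> and \<open>\<real>/2\<pi>\<int>\<close>.
  Both of these are shown to be instances below.
\<close>

class phase_group = ab_group_add +
  fixes proj :: "real \<Rightarrow> 'a"
  assumes proj_add: "proj (s + t) = proj s + proj t"
    and surj_proj: "surj proj"
    and proj_kernel: "(\<forall>t. proj t = 0 \<longleftrightarrow> t = 0) \<or>
      (\<forall>t. proj t = 0 \<longleftrightarrow> (\<exists>n::int. t = 2 * pi * of_int n))"

instantiation real :: phase_group
begin

definition proj_real :: "real \<Rightarrow> real" where "proj_real t = t"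

instance
  by standard (auto simp: proj_real_def surj_def)

end

definition circle_rel :: "real \<Rightarrow> real \<Rightarrow> bool" where
  "circle_rel s t \<longleftrightarrow> (\<exists>n::int. s - t = 2 * pi * of_int n)"

lemma equivp_circle_rel: "equivp circle_rel"
proof (rule equivpI)
  show "reflp circle_rel"
    unfolding reflp_def circle_rel_def by (auto intro: exI[of _ 0])
  show "symp circle_rel"
    unfolding symp_def circle_rel_def
  proof (intro allI impI)
    fix s t :: real assume "\<exists>n::int. s - t = 2 * pi * of_int n"
    then obtain n :: int where "s - t = 2 * pi * of_int n" by blast
    then have "t - s = 2 * pi * of_int (- n)" by simp
    then show "\<exists>n::int. t - s = 2 * pi * of_int n" by blast
  qed
  show "transp circle_rel"
    unfolding transp_def circle_rel_def
  proof (intro allI impI)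
    fix s t u :: real
    assume "\<exists>n::int. s - t = 2 * pi * of_int n" "\<exists>n::int. t - u = 2 * pi * of_int n"
    then obtain n k :: int where "s - t = 2 * pi * of_int n" "t - u = 2 * pi * of_int k" by blast
    then have "s - u = 2 * pi * of_int (n + k)" by (simp add: algebra_simps)
    then show "\<exists>n::int. s - u = 2 * pi * of_int n" by blast
  qed
qed

quotient_type circle = real / circle_rel
  by (rule equivp_circle_rel)

lemma circle_rel_add: "circle_rel (s + s') (t + t')" if "circle_rel s t" "circle_rel s' t'"
proof -
  from that obtain n k :: int where "s - t = 2 * pi * of_int n" "s' - t' = 2 * pi * of_int k"
    unfolding circle_rel_def by blast
  then have "(s + s') - (t + t') = 2 * pi * of_int (n + k)" by (simp add: algebra_simps)
  then show ?thesis unfolding circle_rel_def by blast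
qed

lemma circle_rel_minus: "circle_rel (- s) (- t)" if "circle_rel s t"
proof -
  from that obtain n :: int where "s - t = 2 * pi * of_int n"
    unfolding circle_rel_def by blast
  then have "(- s) - (- t) = 2 * pi * of_int (- n)" by simp
  then show ?thesis unfolding circle_rel_def by blast
qed

lemma circle_rel_refl: "circle_rel s s"
  by (rule equivp_reflp[OF equivp_circle_rel])

instantiation circle :: phase_group
begin

lift_definition zero_circle :: circle is 0 .

lift_definition plus_circle :: "circle \<Rightarrow> circle \<Rightarrow> circle" is "(+)"
  by (rule circle_rel_add)

lift_definition uminus_circle :: "circle \<Rightarrow> circle" is uminus
  by (rule circle_rel_minus)

definition minus_circle :: "circle \<Rightarrow> circle \<Rightarrow> circle" where
  "minus_circle a b = a + - b"

lift_definition proj_circle :: "real \<Rightarrow> circle" is "\<lambda>t. t" .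

instance
proof
  fix a b c :: circle and s t :: real
  show "a + b + c = a + (b + c)"
    by transfer (simp add: add.assoc circle_rel_refl)
  show "a + b = b + a"
    by transfer (simp add: add.commute circle_rel_refl)
  show "0 + a = a"
    by transfer (simp add: circle_rel_refl)
  show "- a + a = 0"
    by transfer (simp add: circle_rel_refl)
  show "a - b = a + - b"
    by (rule minus_circle_def)
  show "proj (s + t) = (proj s + proj t :: circle)"
    by transfer (rule circle_rel_refl)
  have "\<exists>t. c = proj t" for c :: circle
    by transfer (blast intro: circle_rel_refl)
  then show "surj (proj :: real \<Rightarrow> circle)"
    unfolding surj_def by blast
  have "proj t = (0 :: circle) \<longleftrightarrow> (\<exists>n::int. t = 2 * pi * of_int n)" for t
    by transfer (simp add: circle_rel_def)
  then show "(\<forall>t. proj t = (0 :: circle) \<longleftrightarrow> t = 0) \<or>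
      (\<forall>t. proj t = (0 :: circle) \<longleftrightarrow> (\<exists>n::int. t = 2 * pi * of_int n))"
    by blast
qed

end

definition vproj :: "real^'n \<Rightarrow> ('a::phase_group)^'n" where
  "vproj x = (\<chi> i. proj (x $ i))"


section \<open>Smooth submanifolds and analytic dimension\<close>

primrec Ck_on :: "nat \<Rightarrow> 'a::euclidean_space set \<Rightarrow> ('a \<Rightarrow> 'b::euclidean_space) \<Rightarrow> bool" where
  "Ck_on 0 S g \<longleftrightarrow> continuous_on S g"
| "Ck_on (Suc k) S g \<longleftrightarrow> (\<forall>x\<in>S. g differentiable (at x)) \<and>
     (\<forall>v. Ck_on k S (\<lambda>x. frechet_derivative g (at x) v))"

definition smooth_map_on :: "'a::euclidean_space set \<Rightarrow> ('a \<Rightarrow> 'b::euclidean_space) \<Rightarrow> bool" where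
  "smooth_map_on S g \<longleftrightarrow> (\<forall>k. Ck_on k S g)"

definition diffeomorphism :: "'a::euclidean_space set \<Rightarrow> 'a set \<Rightarrow> ('a \<Rightarrow> 'a) \<Rightarrow> bool" where
  "diffeomorphism U W \<psi> \<longleftrightarrow> open U \<and> open W \<and> bij_betw \<psi> U W \<and>
     smooth_map_on U \<psi> \<and> smooth_map_on W (inv_into U \<psi>)"

text \<open>Embedded submanifolds, via slice charts.\<close>

definition smooth_submanifold :: "nat \<Rightarrow> 'a::euclidean_space set \<Rightarrow> bool" where
  "smooth_submanifold k M \<longleftrightarrow> (\<forall>p\<in>M. \<exists>U W \<psi> S. p \<in> U \<and> diffeomorphism U W \<psi> \<and>
     subspace S \<and> dim S = k \<and> \<psi> ` (U \<inter> M) = W \<inter> S)"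

text \<open>
  The smooth structure on the product of copies of the phase space is the one making the covering
  \<open>vproj\<close> a local diffeomorphism, so a subset is a submanifold iff its full preimage is one.

  Every immersed submanifold contains a nonempty embedded one of the same dimension, so restricting
  to embedded submanifolds does not change the supremum. The dimensions occurring are bounded by
  the ambient dimension, so the supremum is a maximum unless \<open>X\<close> is empty; then it is \<open>-\<infinity>\<close>.
\<close>

definition analytic_dim :: "(('a::phase_group)^'n) set \<Rightarrow> ereal" where
  "analytic_dim X =
     (SUP k \<in> {k. \<exists>M. M \<noteq> {} \<and> M \<subseteq> X \<and> smooth_submanifold k (vproj -` M)}. ereal (real k))"

text \<open>
  The real dimension of a closed subgroup \<open>H\<close>, i.e. the dimension of its Lie algebra. Over the
  reals this is the linear dimension if \<open>H\<close> is a subspace.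
\<close>

definition real_dim :: "(('a::phase_group)^'n) set \<Rightarrow> nat" where
  "real_dim H = dim {x :: real^'n. \<forall>t::real. vproj (t *\<^sub>R x) \<in> H}"

lemma real_dim_subspace:
  fixes H :: "(real^'n) set"
  assumes "subspace H"
  shows "real_dim H = dim H"
proof -
  have vproj_id: "vproj x = x" for x :: "real^'n"
    by (simp add: vproj_def proj_real_def)
  have "{x :: real^'n. \<forall>t::real. vproj (t *\<^sub>R x) \<in> H} = H"
  proof (intro equalityI subsetI)
    fix x assume "x \<in> {x :: real^'n. \<forall>t::real. vproj (t *\<^sub>R x) \<in> H}"
    then have "vproj (1 *\<^sub>R x) \<in> H" by blast
    then show "x \<in> H" by (simp add: vproj_id)
  qed (simp add: vproj_id subspace_scale[OF assms])
  then show ?thesis by (simp add: real_dim_def)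
qed


section \<open>Graphs\<close>

definition simple_graph :: "'a set \<Rightarrow> 'a set set \<Rightarrow> bool" where
  "simple_graph V E \<longleftrightarrow> finite V \<and> V \<noteq> {} \<and> (\<forall>e\<in>E. e \<subseteq> V \<and> card e = 2)"

definition neighbours :: "'a set set \<Rightarrow> 'a \<Rightarrow> 'a set" where
  "neighbours E v = {w. {w, v} \<in> E}"

definition vertex_degree :: "'a set set \<Rightarrow> 'a \<Rightarrow> nat" where
  "vertex_degree E v = card (neighbours E v)"

definition connected_components :: "'a set \<Rightarrow> 'a set set \<Rightarrow> 'a set set" where
  "connected_components V E = (\<lambda>v. {w \<in> V. (v, w) \<in> {(a, b). {a, b} \<in> E}\<^sup>*}) ` V"

text \<open>
  An oriented cycle is given by its cyclic sequence of vertices; the successor of the last vertex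
  is the first one. Vertices may repeat, edges may not. In a simple graph this forces the length
  to be at least 3.
\<close>

definition cycle_edges :: "'a list \<Rightarrow> 'a set list" where
  "cycle_edges p = map (\<lambda>i. {p ! i, p ! (Suc i mod length p)}) [0..<length p]"

definition oriented_cycle :: "'a set set \<Rightarrow> 'a list \<Rightarrow> bool" where
  "oriented_cycle E p \<longleftrightarrow> p \<noteq> [] \<and> set (cycle_edges p) \<subseteq> E \<and> distinct (cycle_edges p)"

definition acyclic_graph :: "'a set set \<Rightarrow> bool" where
  "acyclic_graph E \<longleftrightarrow> \<not> (\<exists>p. oriented_cycle E p)"

definition common_edges :: "'a list \<Rightarrow> 'a list \<Rightarrow> 'a set set" where
  "common_edges p q = set (cycle_edges p) \<inter> set (cycle_edges q)"

definition cycle_graph_verts :: "nat \<Rightarrow> (nat \<Rightarrow> 'v list) \<Rightarrow> 'v list set" where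
  "cycle_graph_verts m c = c ` {1..m}"

definition cycle_graph_edges :: "nat \<Rightarrow> (nat \<Rightarrow> 'v list) \<Rightarrow> 'v list set set" where
  "cycle_graph_edges m c =
     {{c i, c j} | i j. i \<in> {1..m} \<and> j \<in> {1..m} \<and> i \<noteq> j \<and> common_edges (c i) (c j) \<noteq> {}}"

definition leaves :: "'a set \<Rightarrow> 'a set set \<Rightarrow> 'a set" where
  "leaves V E = {v \<in> V. vertex_degree E v = 1}"

definition all_leaves_but_one :: "'a set \<Rightarrow> 'a set set \<Rightarrow> 'a set \<Rightarrow> bool" where
  "all_leaves_but_one V E L \<longleftrightarrow> L \<subseteq> V \<and>
     (\<forall>C \<in> connected_components V E. \<exists>r \<in> leaves V E \<inter> C. L \<inter> C = (leaves V E \<inter> C) - {r})"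


section \<open>Homology\<close>

text \<open>An orientation sends an edge to the pair (tail, head).\<close>

definition orientation :: "'v set set \<Rightarrow> ('v set \<Rightarrow> 'v \<times> 'v) \<Rightarrow> bool" where
  "orientation E ori \<longleftrightarrow> (\<forall>e\<in>E. {fst (ori e), snd (ori e)} = e)"

definition incidence :: "('v set \<Rightarrow> 'v \<times> 'v) \<Rightarrow> 'v \<Rightarrow> 'v set \<Rightarrow> int" where
  "incidence ori v e = (if v = snd (ori e) then 1 else if v = fst (ori e) then -1 else 0)"

definition int_scale :: "int \<Rightarrow> 'a::ab_group_add \<Rightarrow> 'a" where
  "int_scale n x = (if 0 \<le> n then (\<Sum>i<nat n. x) else - (\<Sum>i<nat (- n). x))"

definition H0 :: "'v::finite set set \<Rightarrow> ('v set \<Rightarrow> 'v \<times> 'v) \<Rightarrow> (('a::phase_group)^'v) set" where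
  "H0 E ori = {x. \<forall>e\<in>E. (\<Sum>v\<in>UNIV. int_scale (incidence ori v e) (x $ v)) = 0}"

text \<open>Vectors indexed by edges are vectors indexed by all vertex sets that vanish off \<open>E\<close>.\<close>

definition H1 :: "'v::finite set set \<Rightarrow> ('v set \<Rightarrow> 'v \<times> 'v) \<Rightarrow> (real^('v set)) set" where
  "H1 E ori = {y. (\<forall>e. e \<notin> E \<longrightarrow> y $ e = 0) \<and>
     (\<forall>v. (\<Sum>e\<in>E. of_int (incidence ori v e) * y $ e) = 0)}"


section \<open>The vector field\<close>

definition vector_field ::
  "'v::finite set set \<Rightarrow> ('v set \<Rightarrow> 'a::phase_group \<Rightarrow> real) \<Rightarrow> real^'v \<Rightarrow> 'a^'v \<Rightarrow> real^'v" where
  "vector_field E f \<omega> x = (\<chi> v. \<omega> $ v + (\<Sum>w \<in> neighbours E v. f {w, v} (x $ w - x $ v)))"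

definition equilibria ::
  "'v::finite set set \<Rightarrow> ('v set \<Rightarrow> 'a::phase_group \<Rightarrow> real) \<Rightarrow> real^'v \<Rightarrow> ('a^'v) set" where
  "equilibria E f \<omega> = {x. vector_field E f \<omega> x = 0}"

end

theory Submission
  imports Defs
begin

text \<open>
  Lift the equilibria along the covering \<open>vproj\<close> to a set of real vectors. Call
  \<open>x\<^sub>v - x\<^sub>u\<close> the tension of an edge oriented from \<open>u\<close> to \<open>v\<close>, and the value of \<open>f\<close> on it the flow
  through the edge. As \<open>f\<close> is odd, an equilibrium is a vector whose flows have prescribed divergence
  \<open>\<omega>\<close>, so the flows of two equilibria differ by an element of \<open>H\<^sub>1\<close>. Tensions propagate through the
  graph by two mechanisms:

    \<^item> The tensions around a cycle add up to zero, so all but one of them give the last one.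

    \<^item> If every element of \<open>H\<^sub>1\<close> that vanishes on a set \<open>A\<close> of edges also vanishes at \<open>e\<close>, then the
      flows on \<open>A\<close> give the flow at \<open>e\<close>. A flow leaves finitely many tensions in \<open>\<Gamma>\<close>, hence
      countably many real ones.

  List the edges in some order and collect in \<open>S\<close> those not reached by the second mechanism from
  the edges before them. Their number is \<open>dim H\<^sub>1\<close>, because each of them lowers by one the dimension
  of the space of elements of \<open>H\<^sub>1\<close> vanishing on the edges listed so far. Whenever an edge is missed
  by the second mechanism but reached by the first, it need not enter \<open>S\<close>: one is spared. The
  lemma \<open>determined_saving_forest\<close> makes \<open>|F| - |L|\<close> savings. It lists the edges cycle by cycle and
  peels the forest \<open>F\<close>: the next cycle \<open>c\<close> has at most one remaining neighbour \<open>c'\<close>. The edge \<open>e\<close>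
  shared with \<open>c'\<close> comes last in \<open>c\<close>, so it is reached by the first mechanism. If no neighbour of
  \<open>c'\<close> was peeled before, the flow around \<open>c'\<close> vanishes on all edges listed before \<open>e\<close>, so \<open>e\<close> is
  missed by the second one. Thus every cycle that loses a neighbour before being peeled itself
  gives one saving. The others are leaves of \<open>F\<close>, and keeping back one leaf in each component until
  its last neighbour is gone leaves at most \<open>|L|\<close> of them.

  The set \<open>S\<close> turns into a dimension bound although \<open>f\<close> may be discontinuous, since only tensions,
  which are linear in \<open>x\<close>, are used as coordinates. On a \<open>k\<close>-dimensional submanifold, fewer than \<open>k\<close>
  linear functionals have a common level set that is uncountable
  (\<open>submanifold_uncountable_level_set\<close>, from the inverse function theorem). Apply this to the
  tensions on \<open>S\<close> together with a basis of the vectors without tension, the Lie algebra of \<open>H\<^sub>0\<close>. On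
  the level set the tensions of all edges take countably many values, and they give a vector up to
  its component in that Lie algebra. So the level set is countable and \<open>k \<le> dim H\<^sub>0 + |S|\<close>.
\<close>

section \<open>Level sets of few functions on a manifold\<close>

definition continuous_gradient ::
  "'a::euclidean_space set \<Rightarrow> ('a \<Rightarrow> real) \<Rightarrow> ('a \<Rightarrow> 'a) \<Rightarrow> bool" where
  "continuous_gradient W \<phi> G \<longleftrightarrow>
     continuous_on W G \<and> (\<forall>x\<in>W. (\<phi> has_derivative (\<lambda>u. G x \<bullet> u)) (at x))"

lemma continuous_gradient_subset:
  "continuous_gradient W \<phi> G \<Longrightarrow> U \<subseteq> W \<Longrightarrow> continuous_gradient U \<phi> G"
  unfolding continuous_gradient_def by (meson continuous_on_subset subsetD)

text \<open>
  The map \<open>h x = x + (\<phi> x - \<phi> p - G p \<bullet> (x - p)) v\<close> corrects \<open>x\<close> in the single direction \<open>v\<close> by the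
  Taylor remainder of \<open>\<phi>\<close>. Hence it is tangent to the identity at \<open>p\<close>, preserves \<open>S\<close> near \<open>p\<close>, and
  satisfies \<open>G p \<bullet> (h x - p) = \<phi> x - \<phi> p\<close>, so its local inverse \<open>\<sigma>\<close>, recentred at the origin,
  carries a hyperplane into the level set of \<open>\<phi>\<close>. The derivative of \<open>h\<close> is a rank-one perturbation
  of the identity; the explicit formula for its inverse shows that composition with \<open>\<sigma>\<close> keeps
  gradients continuous.
\<close>

lemma straighten_level_set:
  fixes \<phi> :: "'a::euclidean_space \<Rightarrow> real"
  assumes "open W" "subspace S" "p \<in> W" "p \<in> S"
    and grad: "continuous_gradient W \<phi> G"
    and "v \<in> S" and v: "G p \<bullet> v = 1"
  obtains V \<sigma> where "open V" "0 \<in> V" "inj_on \<sigma> V" "\<sigma> ` V \<subseteq> W" "\<sigma> ` (V \<inter> S) \<subseteq> S"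
    "\<And>u. u \<in> V \<Longrightarrow> G p \<bullet> u = 0 \<Longrightarrow> \<phi> (\<sigma> u) = \<phi> p"
    "\<And>\<psi> H. continuous_gradient W \<psi> H \<Longrightarrow> \<exists>H'. continuous_gradient V (\<psi> \<circ> \<sigma>) H'"
proof -
  define h where "h x = x + (\<phi> x - \<phi> p - G p \<bullet> (x - p)) *\<^sub>R v" for x
  define h' where "h' x = id_blinfun + (blinfun_scaleR_left v o\<^sub>L blinfun_inner_left (G x - G p))" for x
  have h': "h' x u = u + ((G x - G p) \<bullet> u) *\<^sub>R v" for x u
    by (simp add: h'_def blinfun.add_left inner_commute)
  have der: "(h has_derivative blinfun_apply (h' x)) (at x)" if "x \<in> W" for x
  proof -
    have "(\<phi> has_derivative (\<lambda>u. G x \<bullet> u)) (at x)"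
      using grad that by (auto simp: continuous_gradient_def)
    then have "(h has_derivative (\<lambda>u. u + (G x \<bullet> u - G p \<bullet> u) *\<^sub>R v)) (at x)"
      unfolding h_def[abs_def] by (auto intro!: derivative_eq_intros simp: inner_diff_left)
    then show ?thesis
      by (simp add: h' [abs_def] inner_diff_left)
  qed
  have cont: "continuous_on W h'"
  proof -
    have "continuous_on W G"
      using grad by (simp add: continuous_gradient_def)
    then show ?thesis
      unfolding h'_def[abs_def] by (intro continuous_intros)
  qed
  have "h' p = id_blinfun"
    by (rule blinfun_eqI) (simp add: h')
  then have inv: "id_blinfun o\<^sub>L h' p = id_blinfun"
    by (simp add: blinfun_eqI)
  obtain U V0 g g' where U: "open U" "U \<subseteq> W" "p \<in> U" "open V0" "h p \<in> V0"
    and hom: "homeomorphism U V0 h g"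
    and g: "\<And>y. y \<in> V0 \<Longrightarrow> (g has_derivative (g' y)) (at y)"
    and g': "\<And>y. y \<in> V0 \<Longrightarrow> g' y = inv (blinfun_apply (h' (g y)))"
    and bij: "\<And>y. y \<in> V0 \<Longrightarrow> bij (blinfun_apply (h' (g y)))"
    using inverse_function_theorem[OF \<open>open W\<close> der cont \<open>p \<in> W\<close> inv] by blast
  have hp: "h p = p"
    by (simp add: h_def)
  have hg: "h (g y) = y" "g y \<in> U" if "y \<in> V0" for y
    using hom that by (auto simp: homeomorphism_def)
  define V where "V = (\<lambda>u. p + u) -` V0"
  define \<sigma> where "\<sigma> u = g (p + u)" for u
  have V: "p + u \<in> V0" if "u \<in> V" for u
    using that by (simp add: V_def)
  have Gv: "G (\<sigma> u) \<bullet> v \<noteq> 0" if "u \<in> V" for u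
  proof
    assume "G (\<sigma> u) \<bullet> v = 0"
    then have "h' (\<sigma> u) v = h' (\<sigma> u) 0"
      using v by (simp add: h' inner_diff_left)
    moreover have "v \<noteq> 0"
      using v by auto
    ultimately show False
      using bij[OF V[OF that]] unfolding \<sigma>_def[symmetric] by (metis bij_is_inj injD)
  qed
  have der_\<sigma>: "(\<sigma> has_derivative
      (\<lambda>w. w - (((G (\<sigma> u) - G p) \<bullet> w) / (G (\<sigma> u) \<bullet> v)) *\<^sub>R v)) (at u)" if "u \<in> V" for u
  proof -
    have "g' (p + u) w = w - (((G (\<sigma> u) - G p) \<bullet> w) / (G (\<sigma> u) \<bullet> v)) *\<^sub>R v" for w
    proof -
      define t where "t = ((G (\<sigma> u) - G p) \<bullet> w) / (G (\<sigma> u) \<bullet> v)"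
      have t: "t * (G (\<sigma> u) \<bullet> v) = (G (\<sigma> u) - G p) \<bullet> w"
        using Gv[OF that] by (simp add: t_def)
      have "h' (\<sigma> u) (w - t *\<^sub>R v) = w + ((G (\<sigma> u) - G p) \<bullet> w - t * (G (\<sigma> u) \<bullet> v)) *\<^sub>R v"
        using v by (simp add: h' inner_diff_right inner_diff_left algebra_simps)
      also have "\<dots> = w"
        by (simp add: t)
      finally have "h' (\<sigma> u) (w - t *\<^sub>R v) = w" .
      moreover have "inj (blinfun_apply (h' (\<sigma> u)))" "g' (p + u) = inv (blinfun_apply (h' (\<sigma> u)))"
        using bij[OF V[OF that]] g'[OF V[OF that]] by (auto simp: \<sigma>_def bij_is_inj)
      ultimately show ?thesis
        unfolding t_def[symmetric] by (metis inv_f_f)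
    qed
    moreover have "((\<lambda>u. g (p + u)) has_derivative (\<lambda>w. g' (p + u) w)) (at u)"
      by (rule has_derivative_compose[where f = "\<lambda>u. p + u" and f' = "\<lambda>w. w", OF _ g[OF V[OF that]]])
        (auto intro!: derivative_eq_intros)
    ultimately show ?thesis
      by (simp add: \<sigma>_def[abs_def])
  qed
  show ?thesis
  proof
    show "open V"
      unfolding V_def by (rule continuous_open_vimage) (use U in \<open>auto intro!: continuous_intros\<close>)
    show "0 \<in> V"
      using U hp by (simp add: V_def)
    show "inj_on \<sigma> V"
      by (rule inj_onI) (metis V \<sigma>_def add_left_cancel hg(1))
    show "\<sigma> ` V \<subseteq> W"
      using V hg(2) U(2) by (auto simp: \<sigma>_def)
    show "\<sigma> ` (V \<inter> S) \<subseteq> S"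
    proof safe
      fix u assume u: "u \<in> V" "u \<in> S"
      define t where "t = \<phi> (\<sigma> u) - \<phi> p - G p \<bullet> (\<sigma> u - p)"
      have "\<sigma> u + t *\<^sub>R v = p + u"
        using hg(1)[OF V[OF u(1)]] by (simp add: \<sigma>_def h_def t_def)
      then have "\<sigma> u = p + u - t *\<^sub>R v"
        by (metis add_diff_cancel_right')
      then show "\<sigma> u \<in> S"
        using assms u by (simp add: subspace_add subspace_diff subspace_scale)
    qed
    show "\<phi> (\<sigma> u) = \<phi> p" if "u \<in> V" "G p \<bullet> u = 0" for u
    proof -
      have "G p \<bullet> (h (\<sigma> u) - p) = \<phi> (\<sigma> u) - \<phi> p"
        using v by (simp add: h_def inner_add_right inner_diff_right)
      then show ?thesis
        using hg(1)[OF V[OF that(1)]] that(2) by (simp add: \<sigma>_def)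
    qed
    show "\<exists>H'. continuous_gradient V (\<psi> \<circ> \<sigma>) H'" if H: "continuous_gradient W \<psi> H" for \<psi> H
    proof -
      have \<sigma>W: "\<sigma> u \<in> W" if "u \<in> V" for u
        using V[OF that] hg(2) U(2) by (auto simp: \<sigma>_def)
      have cont_\<sigma>: "continuous_on V \<sigma>"
        by (meson continuous_at_imp_continuous_on der_\<sigma> has_derivative_continuous)
      have *: "continuous_on V (\<lambda>u. F (\<sigma> u))" if "continuous_on W F" for F :: "'a \<Rightarrow> 'a"
        by (rule continuous_on_compose2[OF that cont_\<sigma>]) (use \<sigma>W in auto)
      define H' where "H' u = H (\<sigma> u) - ((H (\<sigma> u) \<bullet> v) / (G (\<sigma> u) \<bullet> v)) *\<^sub>R (G (\<sigma> u) - G p)" for u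
      have "continuous_on V H'"
        unfolding H'_def[abs_def]
        by (intro continuous_intros *) (use Gv H grad in \<open>auto simp: continuous_gradient_def\<close>)
      moreover have "(\<psi> \<circ> \<sigma> has_derivative (\<lambda>w. H' u \<bullet> w)) (at u)" if "u \<in> V" for u
      proof -
        have "(\<psi> has_derivative (\<lambda>u'. H (\<sigma> u) \<bullet> u')) (at (\<sigma> u))"
          using H \<sigma>W[OF that] by (auto simp: continuous_gradient_def)
        from has_derivative_compose[OF der_\<sigma>[OF that] this]
        show ?thesis
          by (simp add: o_def H'_def inner_diff_left inner_diff_right mult.commute)
      qed
      ultimately show ?thesis
        unfolding continuous_gradient_def by blast
    qed
  qed
qed

lemma uncountable_open_Int_subspace:
  fixes S :: "'a::euclidean_space set"
  assumes "open W" "subspace S" "p \<in> W" "p \<in> S" "0 < dim S"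
  shows "uncountable (W \<inter> S)"
proof -
  obtain v where v: "v \<in> S" "v \<noteq> 0"
    using assms by (metis dim_eq_0 less_irrefl subsetI singletonI insertCI)
  obtain e where e: "e > 0" "ball p e \<subseteq> W"
    using assms openE by blast
  define q where "q = p + (e / (2 * norm v)) *\<^sub>R v"
  have q: "q \<in> ball p e" "q \<in> S" "q \<noteq> p"
    using e v assms by (auto simp: q_def dist_norm subspace_add subspace_scale)
  have "closed_segment p q \<subseteq> W \<inter> S"
    using closed_segment_subset[of p "ball p e" q] closed_segment_subset[of p S q] q e assms
      subspace_imp_convex by (metis (no_types, lifting) centre_in_ball convex_ball le_inf_iff order_trans)
  then show ?thesis
    by (metis countable_subset q(3) uncountable_closed_segment)
qed

text \<open>
  Induction on the number of functions. If the last function has no derivative along \<open>S\<close>, it is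
  constant on balls of \<open>S\<close> and can be dropped. Otherwise its level set is parametrised by a subspace
  of one dimension less, to which the remaining functions are pulled back.
\<close>

lemma uncountable_common_level_set:
  fixes \<phi> :: "nat \<Rightarrow> 'a::euclidean_space \<Rightarrow> real"
  assumes "open W" "subspace S" "p \<in> W" "p \<in> S" "n < dim S"
    and "\<And>i. i < n \<Longrightarrow> \<exists>G. continuous_gradient W (\<phi> i) G"
  shows "\<exists>C \<subseteq> W \<inter> S. uncountable C \<and> (\<forall>i<n. \<phi> i constant_on C)"
  using assms
proof (induction n arbitrary: W S p \<phi>)
  case 0
  then show ?case
    using uncountable_open_Int_subspace by blast
next
  case (Suc n)
  obtain G where G: "continuous_gradient W (\<phi> n) G"
    using Suc.prems(6)[of n] by auto
  show ?case
  proof (cases "\<forall>x\<in>W \<inter> S. \<forall>v\<in>S. G x \<bullet> v = 0")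
    case True
    obtain e where e: "e > 0" "ball p e \<subseteq> W"
      using Suc.prems openE by blast
    have const: "\<phi> n x = \<phi> n y" if "x \<in> ball p e \<inter> S" "y \<in> ball p e \<inter> S" for x y
    proof -
      let ?l = "\<lambda>t. \<phi> n (x + t *\<^sub>R (y - x))"
      have "(?l has_derivative (\<lambda>h. 0)) (at t within {0..1})" if "t \<in> {0..1}" for t
      proof -
        have "x + t *\<^sub>R (y - x) = (1 - t) *\<^sub>R x + t *\<^sub>R y"
          by (simp add: algebra_simps)
        then have mem: "x + t *\<^sub>R (y - x) \<in> W \<inter> S"
          using \<open>x \<in> _\<close> \<open>y \<in> _\<close> e Suc.prems(2) that convexD[OF convex_ball, of x p e y "1 - t" t]
          by (auto simp: subspace_add subspace_scale)
        then have D: "(\<phi> n has_derivative (\<lambda>u. G (x + t *\<^sub>R (y - x)) \<bullet> u)) (at (x + t *\<^sub>R (y - x)))"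
          using G by (auto simp: continuous_gradient_def)
        have "(?l has_derivative (\<lambda>h. G (x + t *\<^sub>R (y - x)) \<bullet> (h *\<^sub>R (y - x)))) (at t within {0..1})"
          by (rule has_derivative_compose[where f = "\<lambda>t. x + t *\<^sub>R (y - x)" and f' = "\<lambda>h. h *\<^sub>R (y - x)", OF _ D])
            (auto intro!: derivative_eq_intros)
        moreover have "G (x + t *\<^sub>R (y - x)) \<bullet> (y - x) = 0"
          using True mem that \<open>x \<in> _\<close> \<open>y \<in> _\<close> Suc.prems(2) by (auto simp: subspace_diff)
        ultimately show ?thesis
          by simp
      qed
      then have "\<exists>c. \<forall>t\<in>{0..1}. ?l t = c"
        by (intro has_derivative_zero_constant) auto
      then have "?l 0 = ?l 1"
        by (metis atLeastAtMost_iff order_refl zero_le_one)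
      then show ?thesis
        by simp
    qed
    have "\<exists>C \<subseteq> ball p e \<inter> S. uncountable C \<and> (\<forall>i<n. \<phi> i constant_on C)"
    proof (rule Suc.IH[of _ _ p])
      show "\<exists>G. continuous_gradient (ball p e) (\<phi> i) G" if "i < n" for i
        using Suc.prems(6)[of i] that e(2) continuous_gradient_subset by (metis less_SucI)
    qed (use Suc.prems e in auto)
    then obtain C where C: "C \<subseteq> ball p e \<inter> S" "uncountable C"
      "\<forall>i<n. \<phi> i constant_on C"
      by blast
    have "\<phi> n constant_on C"
      using C(1) const unfolding constant_on_def by (metis subsetD)
    then have "\<forall>i<Suc n. \<phi> i constant_on C"
      using C(3) by (simp add: less_Suc_eq)
    moreover have "C \<subseteq> W \<inter> S"
      using C(1) e(2) by blast
    ultimately show ?thesis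
      using C(2) by (intro exI[of _ C] conjI)
  next
    case False
    then obtain q w where q: "q \<in> W" "q \<in> S" and w: "w \<in> S" "G q \<bullet> w \<noteq> 0"
      by blast
    define v where "v = (1 / (G q \<bullet> w)) *\<^sub>R w"
    have v: "v \<in> S" "G q \<bullet> v = 1"
      using w Suc.prems(2) by (auto simp: v_def subspace_scale)
    obtain V \<sigma> where V: "open V" "0 \<in> V" "inj_on \<sigma> V" "\<sigma> ` V \<subseteq> W" "\<sigma> ` (V \<inter> S) \<subseteq> S"
      and \<sigma>n: "\<And>u. u \<in> V \<Longrightarrow> G q \<bullet> u = 0 \<Longrightarrow> \<phi> n (\<sigma> u) = \<phi> n q"
      and \<sigma>: "\<And>\<psi> H. continuous_gradient W \<psi> H \<Longrightarrow> \<exists>H'. continuous_gradient V (\<psi> \<circ> \<sigma>) H'"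
      using straighten_level_set[OF Suc.prems(1,2) q G v] by blast
    define T where "T = S \<inter> {u. G q \<bullet> u = 0}"
    have T: "subspace T"
      unfolding T_def using Suc.prems(2) subspace_hyperplane by (rule subspace_inter)
    have dimT: "n < dim T"
    proof -
      have "S \<subseteq> span (insert v T)"
      proof
        fix u assume "u \<in> S"
        then have "u - (G q \<bullet> u) *\<^sub>R v \<in> T"
          using v Suc.prems(2) by (simp add: T_def subspace_diff subspace_scale inner_diff_right)
        then show "u \<in> span (insert v T)"
          unfolding span_insert using span_base by blast
      qed
      then have "dim S \<le> dim (insert v T)"
        by (metis dim_span dim_subset)
      also have "\<dots> \<le> dim T + 1"
        by (simp add: dim_insert)
      finally show ?thesis
        using Suc.prems(5) by simp
    qed
    have "\<exists>C \<subseteq> V \<inter> T. uncountable C \<and> (\<forall>i<n. (\<phi> i \<circ> \<sigma>) constant_on C)"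
    proof (rule Suc.IH[of _ _ 0])
      show "\<exists>G. continuous_gradient V (\<phi> i \<circ> \<sigma>) G" if "i < n" for i
        using Suc.prems(6)[of i] \<sigma> that by auto
    qed (use V T dimT subspace_0 in auto)
    then obtain C where C: "C \<subseteq> V \<inter> T" "uncountable C"
      "\<forall>i<n. (\<phi> i \<circ> \<sigma>) constant_on C"
      by auto
    have "\<phi> n (\<sigma> x) = \<phi> n q" if "x \<in> C" for x
      using that C(1) \<sigma>n by (auto simp: T_def)
    then have "\<phi> n constant_on \<sigma> ` C"
      by (auto simp: constant_on_def)
    moreover have "\<phi> i constant_on \<sigma> ` C" if "i < n" for i
      using C(3) that by (auto simp: constant_on_def)
    ultimately have "\<forall>i<Suc n. \<phi> i constant_on \<sigma> ` C"
      by (simp add: less_Suc_eq)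
    moreover have "uncountable (\<sigma> ` C)"
      using C V(3) by (metis countable_image_inj_on inf.bounded_iff inj_on_subset)
    moreover have "\<sigma> ` C \<subseteq> W \<inter> S"
      using C(1) V(4,5) unfolding T_def by blast
    ultimately show ?thesis
      by blast
  qed
qed

text \<open>
  Stated for linear functionals, given by the vectors in \<open>A\<close>; a chart turns them into functions with
  continuous gradient on a \<open>k\<close>-dimensional subspace.
\<close>

lemma submanifold_uncountable_level_set:
  fixes M A :: "'a::euclidean_space set"
  assumes "smooth_submanifold k M" "M \<noteq> {}" "finite A" "card A < k"
  obtains C where "C \<subseteq> M" "uncountable C" "\<And>a x y. a \<in> A \<Longrightarrow> x \<in> C \<Longrightarrow> y \<in> C \<Longrightarrow> a \<bullet> x = a \<bullet> y"
proof -
  obtain p where "p \<in> M"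
    using assms by blast
  then obtain U W \<psi> S where p: "p \<in> U" and \<psi>: "diffeomorphism U W \<psi>"
    and S: "subspace S" "dim S = k" "\<psi> ` (U \<inter> M) = W \<inter> S"
    using assms(1) unfolding smooth_submanifold_def by blast
  define g where "g = inv_into U \<psi>"
  have W: "open W" "bij_betw \<psi> U W" "Ck_on (Suc 0) W g"
    using \<psi> by (auto simp: diffeomorphism_def smooth_map_on_def g_def)
  have inj: "inj_on \<psi> U" "inj_on g W"
    using W(2) by (auto simp: g_def bij_betw_def inj_on_inv_into)
  define G where "G a x = (\<Sum>b\<in>Basis. (a \<bullet> frechet_derivative g (at x) b) *\<^sub>R b)" for a x
  have G: "continuous_gradient W (\<lambda>x. a \<bullet> g x) (G a)" for a
    unfolding continuous_gradient_def
  proof (intro conjI ballI)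
    show "continuous_on W (G a)"
      unfolding G_def[abs_def] using W(3) by (auto intro!: continuous_intros)
    fix x assume "x \<in> W"
    let ?g' = "frechet_derivative g (at x)"
    have g': "(g has_derivative ?g') (at x)"
      using W(3) \<open>x \<in> W\<close> by (simp add: frechet_derivative_works)
    then have lin: "linear ?g'"
      by (rule has_derivative_linear)
    have "a \<bullet> ?g' u = G a x \<bullet> u" for u
    proof -
      have "?g' u = ?g' (\<Sum>b\<in>Basis. (u \<bullet> b) *\<^sub>R b)"
        by (simp add: euclidean_representation)
      also have "\<dots> = (\<Sum>b\<in>Basis. (u \<bullet> b) *\<^sub>R ?g' b)"
        by (simp add: linear_sum[OF lin] linear_scale[OF lin])
      finally have "a \<bullet> ?g' u = (\<Sum>b\<in>Basis. (u \<bullet> b) * (a \<bullet> ?g' b))"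
        by (simp add: inner_sum_right)
      then show ?thesis
        unfolding G_def inner_sum_left by (simp add: inner_commute[of _ u] mult.commute)
    qed
    then show "((\<lambda>x. a \<bullet> g x) has_derivative (\<lambda>u. G a x \<bullet> u)) (at x)"
      using has_derivative_inner_right[OF g', of a] by simp
  qed
  obtain en where en: "bij_betw en {0..<card A} A"
    using ex_bij_betw_nat_finite[OF \<open>finite A\<close>] by blast
  have "\<psi> p \<in> W \<inter> S"
    using p \<open>p \<in> M\<close> S(3) by blast
  then obtain C where C: "C \<subseteq> W \<inter> S" "uncountable C"
    "\<And>i. i < card A \<Longrightarrow> (\<lambda>x. en i \<bullet> g x) constant_on C"
    using uncountable_common_level_set[OF W(1) S(1), of "\<psi> p" "card A" "\<lambda>i x. en i \<bullet> g x"]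
      G S(2) assms(4) by blast
  show ?thesis
  proof
    show "g ` C \<subseteq> M"
    proof
      fix y assume "y \<in> g ` C"
      then obtain z where z: "z \<in> C" "y = g z"
        by blast
      then have "z \<in> \<psi> ` (U \<inter> M)"
        unfolding S(3) by (intro subsetD[OF C(1)])
      then obtain x where "x \<in> U" "x \<in> M" "y = g (\<psi> x)"
        using z(2) by blast
      then show "y \<in> M"
        using inj(1) by (simp add: g_def)
    qed
    show "uncountable (g ` C)"
      using C(1,2) inj(2) by (metis countable_image_inj_on inf.bounded_iff inj_on_subset)
    fix a x y assume a: "a \<in> A" "x \<in> g ` C" "y \<in> g ` C"
    then obtain i where "i < card A" "a = en i"
      using en by (metis atLeastLessThan_iff bij_betw_imp_surj_on imageE)
    then show "a \<bullet> x = a \<bullet> y"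
      using C(3)[of i] a unfolding constant_on_def by auto
  qed
qed

section \<open>Acyclic graphs\<close>

lemma neighbours_commute: "w \<in> neighbours E v \<longleftrightarrow> v \<in> neighbours E w"
  by (simp add: neighbours_def insert_commute)

lemma no_loop: "acyclic_graph E \<Longrightarrow> v \<notin> neighbours E v"
proof
  assume E: "acyclic_graph E" and "v \<in> neighbours E v"
  then have "oriented_cycle E [v]"
    by (simp add: oriented_cycle_def cycle_edges_def neighbours_def)
  then show False
    using E by (auto simp: acyclic_graph_def)
qed

text \<open>
  From length 3 on, a closed path without repeated vertices has no repeated edges either: two equal
  edges at different positions would traverse the same pair of vertices in opposite directions.
\<close>

lemma oriented_cycleI:
  assumes "distinct xs" "3 \<le> length xs" "successively (\<lambda>a b. {a, b} \<in> E) xs"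
    and close: "{last xs, hd xs} \<in> E"
  shows "oriented_cycle E xs"
proof -
  let ?n = "length xs"
  let ?ed = "\<lambda>i. {xs ! i, xs ! (Suc i mod ?n)}"
  have "inj_on ?ed {..<?n}"
  proof (rule inj_onI, rule ccontr)
    fix i j assume ij: "i \<in> {..<?n}" "j \<in> {..<?n}" "?ed i = ?ed j" "i \<noteq> j"
    have "Suc i mod ?n < ?n" "Suc j mod ?n < ?n"
      using assms(2) by (auto intro: mod_less_divisor)
    then have "i = Suc j mod ?n" "j = Suc i mod ?n"
      using ij assms(1) by (auto simp: doubleton_eq_iff nth_eq_iff_index_eq)
    moreover have "Suc k mod ?n = (if Suc k = ?n then 0 else Suc k)" if "k < ?n" for k
      using that by simp
    ultimately have "Suc j = ?n \<and> i = 0 \<or> i = Suc j" "Suc i = ?n \<and> j = 0 \<or> j = Suc i"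
      using ij(1,2) by (metis lessThan_iff)+
    then show False
      using assms(2) by arith
  qed
  moreover have "?ed i \<in> E" if "i < ?n" for i
  proof (cases "Suc i < ?n")
    case True
    then show ?thesis
      using assms(3) by (simp add: successively_conv_nth)
  next
    case False
    then have "Suc i = ?n"
      using that by simp
    then show ?thesis
      using close assms(2) by (metis diff_Suc_1 hd_conv_nth last_conv_nth length_0_conv
          mod_self nat.distinct(1))
  qed
  ultimately show ?thesis
    using assms(2) unfolding oriented_cycle_def cycle_edges_def
    by (auto simp: distinct_map lessThan_atLeast0)
qed

text \<open>
  A neighbour of the end of a longest path lies on the path, and anything but the second vertex would
  close a cycle.
\<close>

lemma longest_path_end:
  assumes acyclic: "acyclic_graph E"
    and path: "distinct (x # xs)" "set (x # xs) \<subseteq> R" "successively (\<lambda>a b. {a, b} \<in> E) (x # xs)"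
    and longest: "\<And>ys. distinct ys \<Longrightarrow> set ys \<subseteq> R \<Longrightarrow> successively (\<lambda>a b. {a, b} \<in> E) ys \<Longrightarrow>
      length ys \<le> length (x # xs)"
  shows "neighbours E x \<inter> R = (if xs = [] then {} else {hd xs})"
proof -
  have "xs \<noteq> [] \<and> w = hd xs" if w: "w \<in> neighbours E x" "w \<in> R" for w
  proof -
    have wx: "{w, x} \<in> E" "w \<noteq> x"
      using w(1) no_loop[OF acyclic] by (auto simp: neighbours_def)
    have "w \<in> set (x # xs)"
    proof (rule ccontr)
      assume "w \<notin> set (x # xs)"
      then have "length (w # x # xs) \<le> length (x # xs)"
        using path w(2) wx by (intro longest) auto
      then show False by simp
    qed
    then have "w \<in> set xs"
      using wx by simp
    then obtain ys zs where xs: "xs = ys @ w # zs"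
      by (meson split_list)
    have "ys = []"
    proof (rule ccontr)
      assume "ys \<noteq> []"
      moreover have "x # xs = (x # ys @ [w]) @ zs"
        by (simp add: xs)
      then have "successively (\<lambda>a b. {a, b} \<in> E) (x # ys @ [w])" "distinct (x # ys @ [w])"
        using path by (metis successively_append_iff, metis distinct_append)
      ultimately have "oriented_cycle E (x # ys @ [w])"
        using wx by (intro oriented_cycleI) (auto simp: Suc_le_eq)
      then show False
        using acyclic by (auto simp: acyclic_graph_def)
    qed
    then show ?thesis
      by (simp add: xs)
  qed
  moreover have "hd xs \<in> neighbours E x \<inter> R" if "xs \<noteq> []"
    using path that by (cases xs) (auto simp: neighbours_def insert_commute)
  ultimately show ?thesis
    by auto
qed

lemma successively_imp_rtrancl:
  "successively (\<lambda>a b. {a, b} \<in> E) (x # xs) \<Longrightarrow> (x, last (x # xs)) \<in> {(a, b). {a, b} \<in> E}\<^sup>*"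
proof (induction xs arbitrary: x)
  case (Cons y ys)
  then have "(x, y) \<in> {(a, b). {a, b} \<in> E}" "(y, last (y # ys)) \<in> {(a, b). {a, b} \<in> E}\<^sup>*"
    by auto
  then have "(x, last (y # ys)) \<in> {(a, b). {a, b} \<in> E}\<^sup>*"
    by (rule converse_rtrancl_into_rtrancl)
  then show ?case
    by simp
qed simp

text \<open>
  The peeling step, applied to the remaining vertices \<open>R\<close> of a forest; \<open>B\<close> holds the vertices that
  have to wait, at most one per component. Both ends of a longest path in \<open>R\<close> have a single
  neighbour left, and as they lie in one component they are not both in \<open>B\<close>.
\<close>

lemma forest_has_removable_vertex:
  assumes acyclic: "acyclic_graph E" and R: "finite R" "R \<noteq> {}"
    and B: "\<And>p q. p \<in> B \<Longrightarrow> q \<in> B \<Longrightarrow> (p, q) \<in> {(a, b). {a, b} \<in> E}\<^sup>* \<Longrightarrow> p = q"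
  obtains i where "i \<in> R" "neighbours E i \<inter> R = {}"
  | i q where "i \<in> R" "i \<notin> B" "neighbours E i \<inter> R = {q}"
proof -
  let ?path = "\<lambda>ys. distinct ys \<and> set ys \<subseteq> R \<and> successively (\<lambda>a b. {a, b} \<in> E) ys"
  obtain r where "r \<in> R"
    using R by blast
  have bound: "length ys \<le> card R" if "?path ys" for ys
    using that R by (metis card_mono distinct_card)
  have "?path [r]"
    using \<open>r \<in> R\<close> by simp
  then obtain ys where ys: "?path ys" and max: "\<And>zs. ?path zs \<Longrightarrow> length zs \<le> length ys"
    using ex_has_greatest_nat[of ?path "[r]" length "Suc (card R)"] bound by (metis less_Suc_eq_le)
  have "ys \<noteq> []"
    using max[OF \<open>?path [r]\<close>] by auto
  have ends: "neighbours E (hd zs) \<inter> R = (if tl zs = [] then {} else {hd (tl zs)})" "hd zs \<in> R"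
    if path: "?path zs" "length zs = length ys" for zs
  proof -
    obtain x xs where zs: "zs = x # xs"
      using path \<open>ys \<noteq> []\<close> by (cases zs) auto
    show "neighbours E (hd zs) \<inter> R = (if tl zs = [] then {} else {hd (tl zs)})" "hd zs \<in> R"
      using longest_path_end[OF acyclic, of x xs R] path max unfolding zs by auto
  qed
  have rev: "?path (rev ys)"
    using ys by (simp add: successively_rev insert_commute)
  obtain x xs where x: "ys = x # xs"
    using \<open>ys \<noteq> []\<close> by (cases ys) auto
  show ?thesis
  proof (cases "xs = []")
    case True
    then show ?thesis
      using ends[OF ys] that(1)[of x] by (simp add: x)
  next
    case False
    then have ne: "tl (rev ys) \<noteq> []"
      by (simp add: x tl_append split: list.split)
    have "(x, last ys) \<in> {(a, b). {a, b} \<in> E}\<^sup>*"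
      using successively_imp_rtrancl[of E x xs] ys unfolding x by simp
    moreover have "x \<noteq> last ys"
      using ys False by (auto simp: x)
    ultimately have "x \<notin> B \<or> last ys \<notin> B"
      using B by blast
    then show ?thesis
    proof
      assume "x \<notin> B"
      then show ?thesis
        using ends[OF ys refl] False that(2)[of x "hd xs"] by (simp add: x)
    next
      assume "last ys \<notin> B"
      then show ?thesis
        using ends[OF rev] ne that(2)[of "last ys"] by (simp add: hd_rev)
    qed
  qed
qed

lemma all_leaves_but_one_remainder:
  assumes L: "all_leaves_but_one V E L"
    and p: "p \<in> leaves V E - L" and q: "q \<in> leaves V E - L"
    and pq: "(p, q) \<in> {(a, b). {a, b} \<in> E}\<^sup>*"
  shows "p = q"
proof -
  let ?C = "{w \<in> V. (p, w) \<in> {(a, b). {a, b} \<in> E}\<^sup>*}"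
  have "?C \<in> connected_components V E"
    using p by (auto simp: connected_components_def leaves_def)
  then obtain r where "L \<inter> ?C = leaves V E \<inter> ?C - {r}"
    using L by (auto simp: all_leaves_but_one_def)
  moreover have "p \<in> ?C" "q \<in> ?C"
    using p q pq by (auto simp: leaves_def)
  ultimately have "p = r" "q = r"
    using p q by blast+
  then show ?thesis by simp
qed

section \<open>Tensions and flows\<close>

lemma proj_diff: "proj (s - t) = proj s - (proj t :: 'a::phase_group)"
  using proj_add[of "s - t" t, where ?'a = 'a] by simp

text \<open>
  This is all that the argument uses about the difference between \<open>\<real>\<close> and \<open>\<real>/2\<pi>\<int>\<close>: passing from a
  tension in \<open>\<Gamma>\<close> to a real one costs countably many choices.
\<close>

lemma countable_proj_fibre: "countable (proj -` {a :: 'a::phase_group})"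
proof -
  obtain s where s: "a = proj s"
    using surj_proj by (metis surjD)
  have sub: "proj -` {a} \<subseteq> (\<lambda>t. s + t) ` (proj -` {0 :: 'a})"
  proof
    fix t assume "t \<in> proj -` {a}"
    then have "proj (t - s) = (0 :: 'a)"
      by (simp add: proj_diff s)
    then show "t \<in> (\<lambda>t. s + t) ` (proj -` {0 :: 'a})"
      by (intro image_eqI[of _ _ "t - s"]) auto
  qed
  have "proj -` {0 :: 'a} \<subseteq> insert 0 (range (\<lambda>n::int. 2 * pi * of_int n))"
    using proj_kernel[where ?'a = 'a] by auto
  then have "countable (proj -` {0 :: 'a})"
    by (rule countable_subset) auto
  then show ?thesis
    using sub by (meson countable_image countable_subset)
qed

lemma uncountable_fibre:
  assumes "uncountable Y" "countable (h ` Y)"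
  obtains Y' where "Y' \<subseteq> Y" "uncountable Y'" "h constant_on Y'"
proof -
  have "Y = (\<Union>a\<in>h ` Y. {y \<in> Y. h y = a})"
    by auto
  then obtain a where "uncountable {y \<in> Y. h y = a}"
    using assms by (metis (no_types, lifting) countable_UN)
  then show ?thesis
    by (intro that[of "{y \<in> Y. h y = a}"]) (auto simp: constant_on_def)
qed

locale oriented_graph =
  fixes E :: "'v::finite set set" and ori :: "'v set \<Rightarrow> 'v \<times> 'v"
  assumes simple: "simple_graph UNIV E" and ori: "orientation E ori"
begin

definition tension :: "'v set \<Rightarrow> real^'v \<Rightarrow> real" where
  "tension e x = x $ snd (ori e) - x $ fst (ori e)"

lemma ends:
  assumes "e \<in> E"
  shows "{fst (ori e), snd (ori e)} = e" "fst (ori e) \<noteq> snd (ori e)"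
proof -
  show eq: "{fst (ori e), snd (ori e)} = e"
    using ori assms by (simp add: orientation_def)
  have "card e = 2"
    using simple assms by (simp add: simple_graph_def)
  then show "fst (ori e) \<noteq> snd (ori e)"
    using eq by (metis card_1_singleton_iff insert_absorb2 numeral_eq_one_iff One_nat_def
        semiring_norm(85))
qed

lemma tension_ends:
  assumes "{u, v} \<in> E"
  shows "tension {u, v} x = (if snd (ori {u, v}) = v then x $ v - x $ u else x $ u - x $ v)"
  using ends[OF assms] unfolding tension_def by (auto simp: doubleton_eq_iff)

lemma tension_diff: "tension e (x - y) = tension e x - tension e y"
  by (simp add: tension_def)

lemma subspace_H1: "subspace (H1 E ori)"
  unfolding subspace_def H1_def
  by (auto simp: algebra_simps sum.distrib simp flip: sum_distrib_left)

lemma sum_incidence: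
  fixes g :: "'v \<Rightarrow> real"
  assumes "e \<in> E"
  shows "(\<Sum>v\<in>UNIV. of_int (incidence ori v e) * g v) = g (snd (ori e)) - g (fst (ori e))"
proof -
  have "(\<Sum>v\<in>UNIV. of_int (incidence ori v e) * g v) =
      (\<Sum>v\<in>UNIV. (if v = snd (ori e) then g v else 0) - (if v = fst (ori e) then g v else 0))"
    using ends(2)[OF assms] by (intro sum.cong) (auto simp: incidence_def)
  then show ?thesis
    by (simp add: sum_subtractf)
qed

text \<open>
  The incidence matrix and its transpose are adjoint, so flows without divergence are those
  orthogonal to all tensions. Both uses of cycles rest on this: a cycle carries a flow, and the
  tensions around it cancel.
\<close>

lemma H1_iff_orthogonal:
  "y \<in> H1 E ori \<longleftrightarrow>
     (\<forall>e. e \<notin> E \<longrightarrow> y $ e = 0) \<and> (\<forall>x. (\<Sum>e\<in>E. y $ e * tension e x) = 0)"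
proof -
  have *: "(\<Sum>e\<in>E. y $ e * tension e x) =
      (\<Sum>v\<in>UNIV. x $ v * (\<Sum>e\<in>E. of_int (incidence ori v e) * y $ e))" for x
  proof -
    have "(\<Sum>v\<in>UNIV. x $ v * (\<Sum>e\<in>E. of_int (incidence ori v e) * y $ e)) =
        (\<Sum>v\<in>UNIV. \<Sum>e\<in>E. y $ e * (of_int (incidence ori v e) * x $ v))"
      by (simp add: sum_distrib_left mult_ac)
    also have "\<dots> = (\<Sum>e\<in>E. y $ e * (\<Sum>v\<in>UNIV. of_int (incidence ori v e) * x $ v))"
      by (subst sum.swap) (simp add: sum_distrib_left)
    also have "\<dots> = (\<Sum>e\<in>E. y $ e * tension e x)"
      by (intro sum.cong) (simp_all add: sum_incidence tension_def)
    finally show ?thesis by simp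
  qed
  have "(\<Sum>e\<in>E. y $ e * tension e (axis v 1)) = (\<Sum>e\<in>E. of_int (incidence ori v e) * y $ e)" for v
    unfolding * by (simp add: axis_def if_distrib[of "\<lambda>a. a * _"] cong: if_cong)
  then show ?thesis
    unfolding H1_def using * by auto
qed

text \<open>
  The flow has the value \<open>1\<close> on the edges traversed along their orientation and \<open>-1\<close> on the others.
  Since no edge is repeated, nothing cancels and the support is the whole cycle.
\<close>

lemma cycle_flow:
  assumes "oriented_cycle E p"
  obtains y where "y \<in> H1 E ori" "\<And>e. y $ e \<noteq> 0 \<longleftrightarrow> e \<in> set (cycle_edges p)"
proof -
  let ?n = "length p"
  let ?nxt = "\<lambda>i. p ! (Suc i mod ?n)"
  define ed where "ed i = {p ! i, ?nxt i}" for i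
  define sg :: "nat \<Rightarrow> real" where "sg i = (if snd (ori (ed i)) = ?nxt i then 1 else - 1)" for i
  define y :: "real^('v set)" where "y = (\<chi> e. \<Sum>i<?n. if e = ed i then sg i else 0)"
  have ce: "cycle_edges p = map ed [0..<?n]"
    by (simp add: cycle_edges_def ed_def)
  have inj: "inj_on ed {..<?n}" and edE: "\<And>i. i < ?n \<Longrightarrow> ed i \<in> E" and n: "0 < ?n"
    using assms unfolding oriented_cycle_def ce by (auto simp: distinct_map lessThan_atLeast0)
  have y: "y $ ed i = sg i" if "i < ?n" for i
  proof -
    have "y $ ed i = (\<Sum>j<?n. if j = i then sg j else 0)"
      using that unfolding y_def
      by (auto intro!: sum.cong simp: inj_on_eq_iff[OF inj])
    then show ?thesis
      using that by simp
  qed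
  have y0: "y $ e = 0" if "e \<notin> set (cycle_edges p)" for e
    using that unfolding ce y_def by (auto intro!: sum.neutral)
  have "(\<Sum>e\<in>E. y $ e * tension e x) = 0" for x
  proof -
    have "(\<Sum>e\<in>E. y $ e * tension e x) = (\<Sum>e\<in>ed ` {..<?n}. y $ e * tension e x)"
      using edE y0 by (intro sum.mono_neutral_right) (auto simp: ce lessThan_atLeast0)
    also have "\<dots> = (\<Sum>i<?n. sg i * tension (ed i) x)"
      using inj y by (simp add: sum.reindex)
    also have "\<dots> = (\<Sum>i<?n. x $ ?nxt i - x $ (p ! i))"
    proof (intro sum.cong refl)
      fix i assume "i \<in> {..<?n}"
      then have "{p ! i, ?nxt i} \<in> E"
        using edE by (simp add: ed_def)
      then show "sg i * tension (ed i) x = x $ ?nxt i - x $ (p ! i)"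
        by (simp add: sg_def ed_def tension_ends)
    qed
    also have "\<dots> = (\<Sum>i<?n. x $ ?nxt i) - (\<Sum>i<?n. x $ (p ! i))"
      by (simp add: sum_subtractf)
    also have "(\<Sum>i<?n. x $ ?nxt i) = (\<Sum>i<?n. x $ (p ! i))"
    proof -
      obtain k where k: "?n = Suc k"
        using n gr0_implies_Suc by blast
      have "(\<Sum>i<Suc k. x $ (p ! (Suc i mod Suc k))) = (\<Sum>i<k. x $ (p ! Suc i)) + x $ (p ! 0)"
        by simp
      then show ?thesis
        unfolding k by (simp add: sum.lessThan_Suc_shift del: sum.lessThan_Suc)
    qed
    finally show ?thesis by simp
  qed
  moreover have "y $ e = 0" if "e \<notin> E" for e
    using that edE by (intro y0) (auto simp: ce)
  ultimately have "y \<in> H1 E ori"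
    by (simp add: H1_iff_orthogonal)
  moreover have "y $ e \<noteq> 0 \<longleftrightarrow> e \<in> set (cycle_edges p)" for e
  proof
    assume "y $ e \<noteq> 0"
    then show "e \<in> set (cycle_edges p)"
      using y0 by blast
  next
    assume "e \<in> set (cycle_edges p)"
    then obtain i where "i < ?n" "e = ed i"
      by (auto simp: ce)
    then show "y $ e \<noteq> 0"
      by (simp add: y sg_def)
  qed
  ultimately show ?thesis
    by (rule that)
qed

text \<open>
  The vectors without tension span one-parameter subgroups that stay in \<open>H\<^sub>0\<close>.
\<close>

lemma dim_tensionless_le_real_dim_H0:
  "dim {x. \<forall>e\<in>E. tension e x = 0} \<le> real_dim (H0 E ori :: ('a::phase_group^'v) set)"
  unfolding real_dim_def
proof (intro dim_subset subsetI CollectI allI)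
  fix x :: "real^'v" and t :: real
  assume x: "x \<in> {x. \<forall>e\<in>E. tension e x = 0}"
  have "(\<Sum>v\<in>UNIV. int_scale (incidence ori v e) (vproj (t *\<^sub>R x) $ v :: 'a)) = 0" if "e \<in> E" for e
  proof -
    let ?g = "\<lambda>v. proj (t * x $ v) :: 'a"
    have "(\<Sum>v\<in>UNIV. int_scale (incidence ori v e) (vproj (t *\<^sub>R x) $ v :: 'a)) =
        (\<Sum>v\<in>UNIV. (if v = snd (ori e) then ?g v else 0) - (if v = fst (ori e) then ?g v else 0))"
      using ends(2)[OF that]
      by (intro sum.cong) (auto simp: incidence_def int_scale_def vproj_def)
    also have "\<dots> = ?g (snd (ori e)) - ?g (fst (ori e))"
      by (simp add: sum_subtractf)
    finally show ?thesis
      using x that by (auto simp: tension_def)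
  qed
  then show "vproj (t *\<^sub>R x) \<in> (H0 E ori :: ('a^'v) set)"
    by (simp add: H0_def)
qed

end

locale phase_network = oriented_graph E ori
  for E :: "'v::finite set set" and ori :: "'v set \<Rightarrow> 'v \<times> 'v" +
  fixes f :: "'v set \<Rightarrow> 'a::phase_group \<Rightarrow> real" and \<omega> :: "real^'v"
  assumes odd: "\<And>e t. e \<in> E \<Longrightarrow> f e (- t) = - f e t"
    and finite_fibre: "\<And>e y. e \<in> E \<Longrightarrow> finite (f e -` {y})"
begin

definition lifted_equilibria :: "(real^'v) set" where
  "lifted_equilibria = vproj -` equilibria E f \<omega>"

definition flow :: "'v set \<Rightarrow> real^'v \<Rightarrow> real" where
  "flow e x = f e (proj (tension e x))"

lemma flow_balance:
  assumes "x \<in> lifted_equilibria"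
  shows "(\<Sum>e\<in>E. of_int (incidence ori v e) * flow e x) = \<omega> $ v"
proof -
  have v_in: "v \<in> e" if "e \<in> E" "incidence ori v e \<noteq> 0" for e
    using ends(1)[OF that(1)] that(2) by (auto simp: incidence_def split: if_splits)
  have "bij_betw (\<lambda>w. {w, v}) (neighbours E v) {e \<in> E. v \<in> e}"
  proof (rule bij_betwI')
    fix e assume "e \<in> {e \<in> E. v \<in> e}"
    then have "e \<in> E" "v \<in> e" by auto
    then show "\<exists>w\<in>neighbours E v. e = {w, v}"
      using ends(1)[of e] unfolding neighbours_def by (metis insert_commute insert_iff mem_Collect_eq singletonD)
  qed (auto simp: neighbours_def doubleton_eq_iff)
  then have "(\<Sum>e\<in>{e \<in> E. v \<in> e}. of_int (incidence ori v e) * flow e x) =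
      (\<Sum>w\<in>neighbours E v. of_int (incidence ori v {w, v}) * flow {w, v} x)"
    by (rule sum.reindex_bij_betw[symmetric])
  also have "\<dots> = (\<Sum>w\<in>neighbours E v. - f {w, v} (proj (x $ w) - proj (x $ v)))"
  proof (intro sum.cong refl)
    fix w assume "w \<in> neighbours E v"
    then have e: "{w, v} \<in> E"
      by (simp add: neighbours_def)
    have "f {w, v} (proj (x $ v) - proj (x $ w)) = - f {w, v} (proj (x $ w) - proj (x $ v))"
      using odd[OF e, of "proj (x $ w) - proj (x $ v)"] by simp
    then show "of_int (incidence ori v {w, v}) * flow {w, v} x =
        - f {w, v} (proj (x $ w) - proj (x $ v))"
      using ends[OF e] unfolding flow_def incidence_def tension_def
      by (auto simp: doubleton_eq_iff proj_diff)
  qed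
  also have "\<dots> = \<omega> $ v"
  proof -
    have "vector_field E f \<omega> (vproj x) $ v = 0"
      using assms by (simp add: lifted_equilibria_def equilibria_def)
    then show ?thesis
      by (simp add: vector_field_def vproj_def sum_negf)
  qed
  finally show ?thesis
    using v_in by (subst sum.mono_neutral_right[of E "{e \<in> E. v \<in> e}"]) auto
qed

lemma flow_difference_in_H1:
  assumes "x \<in> lifted_equilibria" "x' \<in> lifted_equilibria"
  shows "(\<chi> e. if e \<in> E then flow e x - flow e x' else 0) \<in> H1 E ori"
  unfolding H1_def
proof (intro CollectI conjI allI)
  fix v
  have "(\<Sum>e\<in>E. of_int (incidence ori v e) * (flow e x - flow e x')) = 0"
    by (simp add: right_diff_distrib sum_subtractf flow_balance[OF assms(1)] flow_balance[OF assms(2)])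
  then show "(\<Sum>e\<in>E. of_int (incidence ori v e) *
      (\<chi> e. if e \<in> E then flow e x - flow e x' else 0) $ e) = 0"
    by simp
qed simp

section \<open>Determining all tensions by few\<close>

text \<open>
  Fixing the tensions on \<open>S\<close> leaves countably many choices for those on \<open>A\<close>. Put as a thinning of
  uncountable sets of equilibria, this lets several such choices be made one after another
  without any bookkeeping of their combinations.
\<close>

definition determines :: "'v set set \<Rightarrow> 'v set set \<Rightarrow> bool" where
  "determines S A \<longleftrightarrow> (\<forall>Y\<subseteq>lifted_equilibria. uncountable Y \<longrightarrow> (\<forall>e\<in>S. tension e constant_on Y) \<longrightarrow>
     (\<exists>Y'\<subseteq>Y. uncountable Y' \<and> (\<forall>e\<in>A. tension e constant_on Y')))"

definition H1_vanishing :: "'v set set \<Rightarrow> (real^('v set)) set" where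
  "H1_vanishing A = {y \<in> H1 E ori. \<forall>e\<in>A. y $ e = 0}"

text \<open>
  The number \<open>dim (H1 E ori) - dim (H1_vanishing A)\<close> is the rank of the flows on \<open>A\<close>; as many tensions
  on \<open>A\<close> suffice if only flows are propagated. Here \<open>r\<close> fewer do.
\<close>

definition determined_saving :: "nat \<Rightarrow> 'v set set \<Rightarrow> bool" where
  "determined_saving r A \<longleftrightarrow> (\<exists>S. determines S A \<and> card S + dim (H1_vanishing A) + r \<le> dim (H1 E ori))"

lemma determinesD:
  assumes "determines S A" "Y \<subseteq> lifted_equilibria" "uncountable Y" "\<And>e. e \<in> S \<Longrightarrow> tension e constant_on Y"
  obtains Y' where "Y' \<subseteq> Y" "uncountable Y'" "\<And>e. e \<in> A \<Longrightarrow> tension e constant_on Y'"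
proof -
  have "\<exists>Y'\<subseteq>Y. uncountable Y' \<and> (\<forall>e\<in>A. tension e constant_on Y')"
    using assms(1)[unfolded determines_def, rule_format, OF assms(2,3)] assms(4) by simp
  then show ?thesis
    using that by auto
qed

lemma dim_H1_vanishing_insert_less:
  assumes "y \<in> H1_vanishing A" "y $ e \<noteq> 0"
  shows "dim (H1_vanishing (insert e A)) < dim (H1_vanishing A)"
proof -
  have sub: "subspace (H1_vanishing B)" for B
    using subspace_H1 unfolding H1_vanishing_def subspace_def by auto
  have "H1_vanishing (insert e A) \<subset> H1_vanishing A"
    using assms by (auto simp: H1_vanishing_def)
  then show ?thesis
    using sub by (metis dim_psubset span_eq_iff)
qed

lemma determined_saving_empty: "determined_saving 0 {}"
proof -
  have "determines {} {}"
    by (auto simp: determines_def)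
  then show ?thesis
    unfolding determined_saving_def H1_vanishing_def by (intro exI[of _ "{}"]) simp
qed

lemma determined_saving_insert:
  assumes "determined_saving r A" "e \<in> E"
  shows "determined_saving r (insert e A)"
proof -
  obtain S where S: "determines S A" "card S + dim (H1_vanishing A) + r \<le> dim (H1 E ori)"
    using assms(1) by (auto simp: determined_saving_def)
  show ?thesis
  \<comment> \<open>Either the rank grows and pays for a new tension, or the flow at \<open>e\<close> is already known.\<close>
  proof (cases "\<exists>y\<in>H1_vanishing A. y $ e \<noteq> 0")
    case True
    then have "dim (H1_vanishing (insert e A)) < dim (H1_vanishing A)"
      using dim_H1_vanishing_insert_less by blast
    moreover have "determines (insert e S) (insert e A)"
      unfolding determines_def
    proof (intro allI impI)
      fix Y assume Y: "Y \<subseteq> lifted_equilibria" "uncountable Y" "\<forall>e\<in>insert e S. tension e constant_on Y"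
      obtain Y' where "Y' \<subseteq> Y" "uncountable Y'" "\<And>e. e \<in> A \<Longrightarrow> tension e constant_on Y'"
        using determinesD[OF S(1) Y(1,2)] Y(3) by blast
      then show "\<exists>Y'\<subseteq>Y. uncountable Y' \<and> (\<forall>e\<in>insert e A. tension e constant_on Y')"
        using Y(3) constant_on_subset by (metis insertE insertI1)
    qed
    moreover have "card (insert e S) \<le> Suc (card S)"
      by (rule card_insert_le_m1) auto
    ultimately show ?thesis
      using S(2) unfolding determined_saving_def by (intro exI[of _ "insert e S"]) auto
  next
    case False
    have "determines S (insert e A)"
      unfolding determines_def
    proof (intro allI impI)
      fix Y assume Y: "Y \<subseteq> lifted_equilibria" "uncountable Y" "\<forall>e\<in>S. tension e constant_on Y"
      obtain Y1 where Y1: "Y1 \<subseteq> Y" "uncountable Y1" "\<And>e. e \<in> A \<Longrightarrow> tension e constant_on Y1"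
        using determinesD[OF S(1) Y(1,2)] Y(3) by blast
      obtain x0 where x0: "x0 \<in> Y1"
        using Y1(2) by fastforce
      have "flow e x = flow e x0" if "x \<in> Y1" for x
      proof -
        let ?y = "(\<chi> e. if e \<in> E then flow e x - flow e x0 else 0) :: real^('v set)"
        have "flow e' x = flow e' x0" if "e' \<in> A" for e'
          using Y1(3)[OF that] \<open>x \<in> Y1\<close> x0 by (auto simp: constant_on_def flow_def)
        then have "?y \<in> H1_vanishing A"
          using flow_difference_in_H1[of x x0] that x0 Y1(1) Y(1) by (auto simp: H1_vanishing_def)
        then have "?y $ e = 0"
          using False by blast
        then show ?thesis
          using assms(2) by simp
      qed
      then have "tension e ` Y1 \<subseteq> (\<Union>a\<in>f e -` {flow e x0}. proj -` {a})"
        by (auto simp: flow_def)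
      moreover have "countable (f e -` {flow e x0})"
        using finite_fibre[OF assms(2)] by (rule countable_finite)
      ultimately have "countable (tension e ` Y1)"
        by (meson countable_UN countable_proj_fibre countable_subset)
      from uncountable_fibre[OF Y1(2) this]
      obtain Y' where "Y' \<subseteq> Y1" "uncountable Y'" "tension e constant_on Y'"
        by blast
      then show "\<exists>Y'\<subseteq>Y. uncountable Y' \<and> (\<forall>e\<in>insert e A. tension e constant_on Y')"
        using Y1(1,3) constant_on_subset by (metis insertE order_trans)
    qed
    moreover have "H1_vanishing (insert e A) = H1_vanishing A"
      using False by (auto simp: H1_vanishing_def)
    ultimately show ?thesis
      using S(2) unfolding determined_saving_def by auto
  qed
qed

lemma determined_saving_Un:
  assumes "determined_saving r A" "B \<subseteq> E"
  shows "determined_saving r (A \<union> B)"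
  using finite[of B] assms(2)
proof (induction B rule: finite_induct)
  case empty
  show ?case using assms(1) by simp
next
  case (insert e B)
  then have "determined_saving r (A \<union> B)" "e \<in> E"
    by auto
  then have "determined_saving r (insert e (A \<union> B))"
    by (rule determined_saving_insert)
  then show ?case by simp
qed

text \<open>
  The step that gains: the rank of the flows grows, as \<open>y\<close> shows, while the tension at \<open>e\<close> is already
  known from the rest of the cycle \<open>p\<close>.
\<close>

lemma determined_saving_Suc:
  assumes "determined_saving r A"
    and p: "oriented_cycle E p" "e \<in> set (cycle_edges p)" "set (cycle_edges p) - {e} \<subseteq> A"
    and y: "y \<in> H1_vanishing A" "y $ e \<noteq> 0"
  shows "determined_saving (Suc r) (insert e A)"
proof -
  obtain S where S: "determines S A" "card S + dim (H1_vanishing A) + r \<le> dim (H1 E ori)"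
    using assms(1) by (auto simp: determined_saving_def)
  obtain c where c: "c \<in> H1 E ori" "\<And>e. c $ e \<noteq> 0 \<longleftrightarrow> e \<in> set (cycle_edges p)"
    using cycle_flow[OF p(1)] by metis
  have eE: "e \<in> E"
    using p(1,2) by (auto simp: oriented_cycle_def)
  have "determines S (insert e A)"
    unfolding determines_def
  proof (intro allI impI)
    fix Y assume Y: "Y \<subseteq> lifted_equilibria" "uncountable Y" "\<forall>e\<in>S. tension e constant_on Y"
    obtain Y' where Y': "Y' \<subseteq> Y" "uncountable Y'" "\<And>e. e \<in> A \<Longrightarrow> tension e constant_on Y'"
      using determinesD[OF S(1) Y(1,2)] Y(3) by blast
    have "tension e x = tension e x'" if x: "x \<in> Y'" "x' \<in> Y'" for x x'
    proof -
      have "c $ e' * tension e' (x - x') = 0" if "e' \<noteq> e" for e'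
      proof (cases "e' \<in> set (cycle_edges p)")
        case True
        then have "tension e' constant_on Y'"
          using Y'(3) p(3) that by blast
        then show ?thesis
          using x by (auto simp: constant_on_def tension_diff)
      next
        case False
        then show ?thesis
          using c(2) by auto
      qed
      then have "(\<Sum>e'\<in>E - {e}. c $ e' * tension e' (x - x')) = 0"
        by (intro sum.neutral) blast
      then have "(\<Sum>e'\<in>E. c $ e' * tension e' (x - x')) = c $ e * tension e (x - x')"
        using eE by (subst sum.remove[of E e]) simp_all
      then have "c $ e * tension e (x - x') = 0"
        using c(1) by (simp add: H1_iff_orthogonal)
      then show ?thesis
        using c(2)[of e] p(2) by (simp add: tension_diff)
    qed
    then have "tension e constant_on Y'"
      unfolding constant_on_def by blast
    then show "\<exists>Y'\<subseteq>Y. uncountable Y' \<and> (\<forall>e\<in>insert e A. tension e constant_on Y')"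
      using Y' by (intro exI[of _ Y']) auto
  qed
  then show ?thesis
    using S(2) dim_H1_vanishing_insert_less[OF y] unfolding determined_saving_def by (intro exI[of _ S]) auto
qed

text \<open>
  Peel the forest of cycles vertex by vertex. Here \<open>D\<close> is the set of cycles peeled so far, and
  \<open>counted D\<close> bounds the savings from below: it holds the peeled cycles outside \<open>L\<close> and the remaining
  ones that have lost a neighbour. The leaves outside \<open>L\<close>, one for each component, have to wait for
  their neighbour. Therefore a cycle outside \<open>L\<close> has lost a neighbour when it is peeled, so peeling it
  adds nothing to \<open>counted D\<close>, and only its last remaining neighbour can be a new element.
\<close>

lemma determined_saving_forest:
  fixes VF :: "'v list set" and EF :: "'v list set set"
  assumes fin: "finite VF"
    and cyc: "\<And>p. p \<in> VF \<Longrightarrow> oriented_cycle E p"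
    and adj: "\<And>p q. q \<in> neighbours EF p \<longleftrightarrow> p \<in> VF \<and> q \<in> VF \<and> p \<noteq> q \<and> common_edges p q \<noteq> {}"
    and one: "\<And>p q. p \<in> VF \<Longrightarrow> q \<in> VF \<Longrightarrow> p \<noteq> q \<Longrightarrow> card (common_edges p q) \<le> 1"
    and acyclic: "acyclic_graph EF"
    and isolated: "\<And>p. p \<in> VF \<Longrightarrow> neighbours EF p \<noteq> {}"
    and L: "all_leaves_but_one VF EF L"
  shows "\<exists>r. determined_saving r E \<and> card VF \<le> r + card L"
proof -
  let ?N = "neighbours EF"
  define U where "U D = (\<Union>p\<in>D. set (cycle_edges p))" for D :: "'v list set"
  define counted where "counted D = (D - L) \<union> {p \<in> VF - D. ?N p \<inter> D \<noteq> {}}" for D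
  have N_VF: "?N p \<subseteq> VF" for p
    using adj by auto
  have UE: "U D \<subseteq> E" if "D \<subseteq> VF" for D
    using cyc that by (auto simp: U_def oriented_cycle_def)
  have step: "\<exists>i r'. i \<in> VF - D \<and> determined_saving r' (U (insert i D)) \<and> card (counted (insert i D)) \<le> r'"
    if D: "D \<subset> VF" and r: "determined_saving r (U D)" "card (counted D) \<le> r" for D r
  proof -
    have fin_c: "finite (counted D)"
      using fin D by (auto simp: counted_def intro: finite_subset)
    have U_insert: "U (insert i D) = U D \<union> set (cycle_edges i)" for i
      by (auto simp: U_def)
    have keep: "determined_saving r (U (insert i D))" if "i \<in> VF" for i
      unfolding U_insert using cyc[OF that] by (intro determined_saving_Un[OF r(1)]) (simp add: oriented_cycle_def)
    have "finite (VF - D)" "VF - D \<noteq> {}"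
      using fin D by auto
    then consider i where "i \<in> VF - D" "?N i \<inter> (VF - D) = {}"
      | i q where "i \<in> VF - D" "i \<notin> leaves VF EF - L" "?N i \<inter> (VF - D) = {q}"
      using forest_has_removable_vertex[OF acyclic, of "VF - D" "leaves VF EF - L"]
        all_leaves_but_one_remainder[OF L] by metis
    then show ?thesis
    proof cases
      case 1
      have "?N i \<inter> D \<noteq> {}"
        using isolated[of i] N_VF[of i] 1 by blast
      then have "counted (insert i D) \<subseteq> counted D"
        using 1 neighbours_commute[of i EF] by (auto simp: counted_def)
      then have "card (counted (insert i D)) \<le> r"
        using fin_c r(2) by (meson card_mono order_trans)
      then show ?thesis
        using 1 keep by blast
    next
      case 2
      then have q: "q \<in> VF - D" "q \<in> ?N i" "i \<in> ?N q"
        using neighbours_commute by fast+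
      \<comment> \<open>If \<open>i\<close> had lost no neighbour, \<open>q\<close> would be its only one, and \<open>i\<close> a leaf outside \<open>L\<close>.\<close>
      have i_counted: "i \<in> counted D" if "i \<in> counted (insert i D)"
      proof -
        have "i \<notin> L"
          using that by (auto simp: counted_def)
        then have "vertex_degree EF i \<noteq> 1"
          using 2(1,2) by (auto simp: leaves_def)
        then have "?N i \<noteq> {q}"
          unfolding vertex_degree_def by (metis is_singletonI is_singleton_altdef)
        moreover have "?N i = ?N i \<inter> (VF - D)" if "?N i \<inter> D = {}"
          using that N_VF[of i] by blast
        ultimately have "?N i \<inter> D \<noteq> {}"
          using 2(3) by metis
        then show ?thesis
          using 2(1) by (auto simp: counted_def)
      qed
      have sub: "counted (insert i D) \<subseteq> insert q (counted D)"
      proof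
        fix p assume p: "p \<in> counted (insert i D)"
        show "p \<in> insert q (counted D)"
        proof (cases "p = i")
          case True
          then show ?thesis using i_counted p by simp
        next
          case False
          then show ?thesis
            using p 2(3) neighbours_commute[of i EF p] by (auto simp: counted_def)
        qed
      qed
      show ?thesis
      proof (cases "q \<in> counted D")
        case True
        then have "counted (insert i D) \<subseteq> counted D"
          using sub by (simp add: insert_absorb)
        then have "card (counted (insert i D)) \<le> r"
          using fin_c r(2) by (meson card_mono order_trans)
        then show ?thesis
          using 2 keep by blast
      next
        case False
        have "card (counted (insert i D)) \<le> card (insert q (counted D))"
          by (rule card_mono[OF _ sub]) (simp add: fin_c)
        also have "\<dots> \<le> Suc r"
          using r(2) fin_c False by simp
        finally have "card (counted (insert i D)) \<le> Suc r" .
        moreover have "determined_saving (Suc r) (U (insert i D))"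
        proof -
          have iq: "i \<in> VF" "q \<in> VF" "i \<noteq> q" "common_edges i q \<noteq> {}"
            using adj q(2) by auto
          have "finite (common_edges i q)"
            by (simp add: common_edges_def)
          then have "card (common_edges i q) = 1"
            using one[OF iq(1-3)] iq(4) by (metis card_0_eq le_antisym less_one not_less)
          then obtain e where e: "common_edges i q = {e}"
            by (meson card_1_singletonE)
          \<comment> \<open>The edge \<open>e\<close> is listed last in the cycle \<open>i\<close>; the flow around \<open>q\<close> avoids all edges before it.\<close>
          let ?A = "U D \<union> (set (cycle_edges i) - {e})"
          have "determined_saving r ?A"
            using r(1) cyc[OF iq(1)] by (intro determined_saving_Un) (auto simp: oriented_cycle_def)
          moreover obtain y where y: "y \<in> H1 E ori" "\<And>e. y $ e \<noteq> 0 \<longleftrightarrow> e \<in> set (cycle_edges q)"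
            using cycle_flow[OF cyc[OF iq(2)]] by metis
          have "set (cycle_edges q) \<inter> ?A = {}"
          proof -
            have "set (cycle_edges q) \<inter> set (cycle_edges p) = {}" if "p \<in> D" for p
            proof -
              have "p \<notin> ?N q"
                using False q(1) that by (auto simp: counted_def)
              then show ?thesis
                using adj[of p q] q(1) that D by (auto simp: common_edges_def)
            qed
            then show ?thesis
              using e by (auto simp: U_def common_edges_def)
          qed
          then have "y \<in> H1_vanishing ?A"
            using y by (auto simp: H1_vanishing_def)
          moreover have "e \<in> set (cycle_edges i)" "y $ e \<noteq> 0"
            using e y(2) by (auto simp: common_edges_def)
          ultimately have "determined_saving (Suc r) (insert e ?A)"
            using cyc[OF iq(1)] by (intro determined_saving_Suc) auto
          moreover have "insert e ?A = U (insert i D)"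
            using \<open>e \<in> set (cycle_edges i)\<close> by (auto simp: U_insert)
          ultimately show ?thesis by simp
        qed
        ultimately show ?thesis
          using 2(1) by blast
      qed
    qed
  qed
  have "n \<le> card VF \<Longrightarrow> \<exists>D r. D \<subseteq> VF \<and> card D = n \<and> determined_saving r (U D) \<and> card (counted D) \<le> r" for n
  proof (induction n)
    case 0
    have "determined_saving 0 (U {})" "card (counted {}) \<le> 0"
      using determined_saving_empty by (auto simp: U_def counted_def)
    then show ?case
      by (intro exI[of _ "{}"] exI[of _ 0]) simp
  next
    case (Suc n)
    then obtain D r where D: "D \<subseteq> VF" "card D = n" "determined_saving r (U D)" "card (counted D) \<le> r"
      by auto
    then have "D \<subset> VF"
      using Suc.prems by auto
    from step[OF this D(3,4)] obtain i r' where i: "i \<in> VF - D" "determined_saving r' (U (insert i D))"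
      "card (counted (insert i D)) \<le> r'"
      by blast
    moreover have "card (insert i D) = Suc n"
      using i(1) D fin by (simp add: finite_subset)
    ultimately show ?case
      using D(1) by (intro exI[of _ "insert i D"] exI[of _ r']) simp
  qed
  from this[OF order_refl] obtain D r where
    D: "D \<subseteq> VF" "card D = card VF" "determined_saving r (U D)" "card (counted D) \<le> r"
    by blast
  have "D = VF"
    using D fin by (simp add: card_subset_eq)
  have "L \<subseteq> VF"
    using L by (simp add: all_leaves_but_one_def)
  then have "card VF - card L \<le> card (counted D)"
    using fin by (simp add: \<open>D = VF\<close> counted_def card_Diff_subset finite_subset)
  moreover have "determined_saving r E"
    using determined_saving_Un[OF D(3), of E] UE[OF D(1)] by (simp add: Un_absorb1)
  ultimately show ?thesis
    using D(4) by (intro exI[of _ r]) linarith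
qed

section \<open>The bound on the dimension\<close>

text \<open>
  If \<open>k\<close> were larger, the tensions on a determining set and the coordinates along the tensionless
  vectors would be fewer than \<open>k\<close> functionals. On an uncountable level set of theirs, all tensions can
  be made constant as well, but then it consists of a single point.
\<close>

lemma submanifold_dim_le:
  assumes M: "smooth_submanifold k M" "M \<noteq> {}" "M \<subseteq> lifted_equilibria" and "determined_saving r E"
  shows "k + r \<le> dim {x. \<forall>e\<in>E. tension e x = 0} + dim (H1 E ori)"
proof (rule ccontr)
  assume contra: "\<not> ?thesis"
  define K where "K = {x. \<forall>e\<in>E. tension e x = 0}"
  obtain S where S: "determines S E" "card S + dim (H1_vanishing E) + r \<le> dim (H1 E ori)"
    using assms(4) by (auto simp: determined_saving_def)
  obtain B where B: "B \<subseteq> K" "independent B" "K \<subseteq> span B" "card B = dim K"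
    using basis_exists by blast
  define a where "a e = axis (snd (ori e)) 1 - axis (fst (ori e)) (1 :: real)" for e
  have a: "a e \<bullet> x = tension e x" for e x
    by (simp add: a_def tension_def inner_diff_left inner_axis_axis inner_axis')
  have "card (B \<union> a ` S) < k"
  proof -
    have "card (B \<union> a ` S) \<le> card B + card S"
      by (meson add_left_mono card_Un_le card_image_le finite order_trans)
    then show ?thesis
      using contra S(2) B(4) by (simp add: K_def)
  qed
  moreover have "finite (B \<union> a ` S)"
    using B(2) independent_imp_finite by auto
  ultimately obtain C where C: "C \<subseteq> M" "uncountable C"
    "\<And>b x y. b \<in> B \<union> a ` S \<Longrightarrow> x \<in> C \<Longrightarrow> y \<in> C \<Longrightarrow> b \<bullet> x = b \<bullet> y"
    using submanifold_uncountable_level_set[OF M(1,2)] by metis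
  have "tension e constant_on C" if "e \<in> S" for e
    using C(3)[of "a e"] that unfolding constant_on_def a by blast
  then obtain Y where Y: "Y \<subseteq> C" "uncountable Y" "\<And>e. e \<in> E \<Longrightarrow> tension e constant_on Y"
    using determinesD[OF S(1) _ C(2)] C(1) M(3) by (metis order_trans)
  have "x = x'" if x: "x \<in> Y" "x' \<in> Y" for x x'
  proof -
    have "tension e x = tension e x'" if "e \<in> E" for e
      using Y(3)[OF that] x by (auto simp: constant_on_def)
    then have "x - x' \<in> K"
      by (simp add: K_def tension_diff)
    moreover have "orthogonal (x - x') b" if "b \<in> B" for b
    proof -
      have "b \<bullet> x = b \<bullet> x'"
        using C(3)[of b x x'] x Y(1) that by blast
      then show ?thesis
        by (simp add: orthogonal_def inner_commute[of _ b] inner_diff_right)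
    qed
    ultimately have "orthogonal (x - x') (x - x')"
      using B(3) orthogonal_to_span by blast
    then show ?thesis
      by (simp add: orthogonal_self)
  qed
  then have "countable Y"
    by (metis countable_empty countable_insert countable_subset equals0I insertI1 subsetI)
  then show False
    using Y(2) by blast
qed

end

text \<open>
  Two indices of the same cycle would therefore have more than one common edge, so the cycles of the
  theorem are pairwise distinct and the vertices of \<open>F\<close> correspond to the indices.
\<close>

lemma oriented_cycle_length:
  assumes "simple_graph V E" "oriented_cycle E p"
  shows "2 \<le> card (set (cycle_edges p))"
proof -
  have "length p \<noteq> 1"
  proof
    assume "length p = 1"
    then have "{p ! 0} \<in> E"
      using assms(2) by (auto simp: oriented_cycle_def cycle_edges_def)
    then show False
      using assms(1) by (auto simp: simple_graph_def)
  qed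
  moreover have "card (set (cycle_edges p)) = length p"
    using assms(2) by (metis cycle_edges_def distinct_card length_map length_upt minus_nat.diff_0
        oriented_cycle_def)
  moreover have "length p \<noteq> 0"
    using assms(2) by (simp add: oriented_cycle_def)
  ultimately show ?thesis
    by linarith
qed

theorem theorem29:
  fixes E :: "'v::finite set set"
    and f :: "'v set \<Rightarrow> 'a::phase_group \<Rightarrow> real"
    and \<omega> :: "real^'v"
    and d m :: nat
    and c :: "nat \<Rightarrow> 'v list"
    and L :: "'v list set"
    and ori :: "'v set \<Rightarrow> 'v \<times> 'v"
  defines "VF \<equiv> cycle_graph_verts m c"
    and "EF \<equiv> cycle_graph_edges m c"
  assumes "simple_graph (UNIV :: 'v set) E"
    and "orientation E ori"
    and "\<And>e t. e \<in> E \<Longrightarrow> f e (- t) = - f e t"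
    and "\<And>e y. e \<in> E \<Longrightarrow> finite (f e -` {y}) \<and> card (f e -` {y}) \<le> d"
    and "\<And>i. i \<in> {1..m} \<Longrightarrow> oriented_cycle E (c i)"
    and "\<And>i j. i \<in> {1..m} \<Longrightarrow> j \<in> {1..m} \<Longrightarrow> i \<noteq> j \<Longrightarrow> card (common_edges (c i) (c j)) \<le> 1"
    and "acyclic_graph EF"
    and "\<And>p. p \<in> VF \<Longrightarrow> vertex_degree EF p \<noteq> 0"
    and "all_leaves_but_one VF EF L"
  shows "analytic_dim (equilibria E f \<omega>) \<le>
    ereal (real (real_dim (H0 E ori :: ('a^'v) set)) + real (dim (H1 E ori))
      - real (card VF) + real (card L))"
proof -
  interpret phase_network E ori f \<omega>
    using assms(3-6) by unfold_locales auto
  have inj: "c i \<noteq> c j" if "i \<in> {1..m}" "j \<in> {1..m}" "i \<noteq> j" for i j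
  proof
    assume "c i = c j"
    then have "card (set (cycle_edges (c i))) \<le> 1"
      using assms(8)[OF that] by (simp add: common_edges_def)
    then show False
      using oriented_cycle_length[OF assms(3) assms(7)[OF that(1)]] by linarith
  qed
  have "\<exists>r. determined_saving r E \<and> card VF \<le> r + card L"
  proof (rule determined_saving_forest[OF _ _ _ _ assms(9) _ assms(11)])
    show "finite VF"
      by (simp add: VF_def cycle_graph_verts_def)
    show "oriented_cycle E p" if "p \<in> VF" for p
      using that assms(7) by (auto simp: VF_def cycle_graph_verts_def)
    show "neighbours EF p \<noteq> {}" if "p \<in> VF" for p
      using assms(10)[OF that] by (auto simp: vertex_degree_def)
    show "card (common_edges p q) \<le> 1" if pq: "p \<in> VF" "q \<in> VF" "p \<noteq> q" for p q
    proof -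
      obtain i j where "i \<in> {1..m}" "j \<in> {1..m}" "p = c i" "q = c j"
        using pq(1,2) unfolding VF_def cycle_graph_verts_def by blast
      then show ?thesis
        using assms(8)[of i j] pq(3) by blast
    qed
    show "q \<in> neighbours EF p \<longleftrightarrow> p \<in> VF \<and> q \<in> VF \<and> p \<noteq> q \<and> common_edges p q \<noteq> {}" for p q
    proof
      assume "q \<in> neighbours EF p"
      then obtain i j where ij: "{q, p} = {c i, c j}" "i \<in> {1..m}" "j \<in> {1..m}" "i \<noteq> j"
        "common_edges (c i) (c j) \<noteq> {}"
        unfolding neighbours_def EF_def cycle_graph_edges_def by blast
      then have "c i \<noteq> c j" "c i \<in> VF" "c j \<in> VF" "common_edges (c j) (c i) \<noteq> {}"
        using inj by (auto simp: VF_def cycle_graph_verts_def common_edges_def)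
      then show "p \<in> VF \<and> q \<in> VF \<and> p \<noteq> q \<and> common_edges p q \<noteq> {}"
        using ij(1,5) by (auto simp: doubleton_eq_iff)
    next
      assume pq: "p \<in> VF \<and> q \<in> VF \<and> p \<noteq> q \<and> common_edges p q \<noteq> {}"
      then obtain i j where ij: "i \<in> {1..m}" "p = c i" "j \<in> {1..m}" "q = c j"
        unfolding VF_def cycle_graph_verts_def by blast
      then have "i \<noteq> j" "{q, p} = {c i, c j}"
        using pq by auto
      then show "q \<in> neighbours EF p"
        using pq ij unfolding neighbours_def EF_def cycle_graph_edges_def by blast
    qed
  qed
  then obtain r where r: "determined_saving r E" "card VF \<le> r + card L"
    by blast
  show ?thesis
    unfolding analytic_dim_def
  proof (rule SUP_least)
    fix k assume "k \<in> {k. \<exists>M. M \<noteq> {} \<and> M \<subseteq> equilibria E f \<omega> \<and> smooth_submanifold k (vproj -` M)}"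
    then obtain M where M: "M \<noteq> {}" "M \<subseteq> equilibria E f \<omega>" "smooth_submanifold k (vproj -` M)"
      by blast
    have "surj (vproj :: real^'v \<Rightarrow> 'a^'v)"
    proof (rule surjI)
      fix y :: "'a^'v"
      show "vproj (\<chi> i. inv proj (y $ i)) = y"
        by (simp add: vproj_def vec_eq_iff surj_f_inv_f[OF surj_proj])
    qed
    then have "vproj -` M \<noteq> {}"
      using M(1) by (metis image_vimage_eq inf_top.right_neutral image_empty)
    moreover have "vproj -` M \<subseteq> lifted_equilibria"
      using M(2) by (auto simp: lifted_equilibria_def)
    ultimately have "k + r \<le> dim {x. \<forall>e\<in>E. tension e x = 0} + dim (H1 E ori)"
      using M(3) r(1) by (intro submanifold_dim_le)
    then have "k + card VF \<le> real_dim (H0 E ori :: ('a^'v) set) + dim (H1 E ori) + card L"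
      using r(2) dim_tensionless_le_real_dim_H0[where ?'a = 'a] by linarith
    then have "real k + real (card VF) \<le>
        real (real_dim (H0 E ori :: ('a^'v) set)) + real (dim (H1 E ori)) + real (card L)"
      by (simp flip: of_nat_add)
    then show "ereal (real k) \<le> ereal (real (real_dim (H0 E ori :: ('a^'v) set)) +
        real (dim (H1 E ori)) - real (card VF) + real (card L))"
      by simp
  qed
qed

end
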